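(* Let $A\in\mathbb{C}^{n\times n}$ be non-nilpotent with $\mathrm{ind}(A)=k$. Then $$A^{\text{cEP}}=\lim_{\lambda\to 0}A^{k}(A^{k+1})^{*}\bigl(A^{k+1}(A^{k+1})^{*}+\lambda I\bigr)^{-1}=\lim_{\lambda\to 0}A^{k}\bigl((A^{k+1})^{*}A^{k+1}+\lambda I\bigr)^{-1}(A^{k+1})^{*}$$ and $$A_{\text{cEP}}=\lim_{\lambda\to 0}\bigl((A^{k+1})^{*}A^{k+1}+\lambda I\bigr)^{-1}(A^{k+1})^{*}A^{k}=\lim_{\lambda\to 0}(A^{k+1})^{*}\bigl(A^{k+1}(A^{k+1})^{*}+\lambda I\bigr)^{-1}A^{k},$$ where $A^{\text{cEP}}$ is the core-EP inverse of $A$ and $A_{\text{cEP}}$ is the dual core-EP inverse of $A$.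
   Context: $M^*$ is the conjugate transpose, $\mathrm{rk}(M)$ the rank, $R(M)$ the range (column space) of a complex matrix $M$, and $I$ is the identity matrix. The index $\mathrm{ind}(A)$ of a square matrix $A$ is the smallest nonnegative integer $k$ with $\mathrm{rk}(A^k)=\mathrm{rk}(A^{k+1})$. The Drazin inverse $A^D$ of $A\in\mathbb{C}^{n\times n}$ with $k=\mathrm{ind}(A)$ is the unique matrix with $A^{k+1}A^D=A^k$, $A^DAA^D=A^D$, $AA^D=A^DA$. The core-EP inverse $A^{\text{cEP}}$ is the unique matrix $X\in\mathbb{C}^{n\times n}$ with $XAX=X$ and $R(X)=R(X^* )=R(A^D)$. The dual core-EP inverse $A_{\text{cEP}}$ is the unique matrix $X\in\mathbb{C}^{n\times n}$ with $XAX=X$ and $R(X)=R(X^* )=R((A^* )^D)$. Limits are taken as $\lambda\to0$ through nonzero complex scalars; for all sufficiently small $\lambda\ne 0$ the indicated inverses exist. *)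

theory Defs
  imports "HOL-Analysis.Analysis"
begin

definition conj_transpose :: "complex^'n^'m \<Rightarrow> complex^'m^'n"
  where "conj_transpose M = map_matrix cnj (transpose M)"

text \<open>The type-class power on \<open>complex^'n^'n\<close> is the componentwise one, so powers with
  respect to the matrix product \<open>**\<close> need their own function.\<close>

primrec mat_pow :: "complex^'n^'n \<Rightarrow> nat \<Rightarrow> complex^'n^'n"
  where
    "mat_pow A 0 = mat 1"
  | "mat_pow A (Suc m) = A ** mat_pow A m"

definition nilpotent_mat :: "complex^'n^'n \<Rightarrow> bool"
  where "nilpotent_mat A \<longleftrightarrow> (\<exists>m. mat_pow A m = 0)"

definition mat_range :: "complex^'n^'m \<Rightarrow> (complex^'m) set"
  where "mat_range M = range ((*v) M)"

definition mat_index :: "complex^'n^'n \<Rightarrow> nat"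
  where "mat_index A = (LEAST k. rank (mat_pow A k) = rank (mat_pow A (k + 1)))"

definition drazin_inverse :: "complex^'n^'n \<Rightarrow> complex^'n^'n"
  where "drazin_inverse A =
    (THE X. mat_pow A (mat_index A + 1) ** X = mat_pow A (mat_index A) \<and>
            X ** A ** X = X \<and> A ** X = X ** A)"

definition core_EP_inverse :: "complex^'n^'n \<Rightarrow> complex^'n^'n"
  where "core_EP_inverse A =
    (THE X. X ** A ** X = X \<and> mat_range X = mat_range (conj_transpose X) \<and>
            mat_range (conj_transpose X) = mat_range (drazin_inverse A))"

definition dual_core_EP_inverse :: "complex^'n^'n \<Rightarrow> complex^'n^'n"
  where "dual_core_EP_inverse A =
    (THE X. X ** A ** X = X \<and> mat_range X = mat_range (conj_transpose X) \<and>
            mat_range (conj_transpose X) = mat_range (drazin_inverse (conj_transpose A)))"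

end

theory Submission
  imports Defs
begin

text \<open>Write \<open>C = A\<^bsup>k+1\<^esup>\<close> and \<open>H = C\<^sup>*C\<close>. As \<open>H\<close> is Hermitian, it has a group inverse \<open>G\<close>; with
  the projection \<open>P = HG\<close> one has \<open>(H + \<lambda>I)\<^sup>-\<^sup>1 = \<lambda>\<^sup>-\<^sup>1(I - P) + G(I + \<lambda>G)\<^sup>-\<^sup>1\<close>. The singular part
  vanishes on the range of \<open>C\<^sup>*\<close>, so \<open>(H + \<lambda>I)\<^sup>-\<^sup>1C\<^sup>*\<close> tends to \<open>GC\<^sup>*\<close>, which is the Moore--Penrose
  inverse \<open>T\<close> of \<open>C\<close>; by the push-through identity so does \<open>C\<^sup>*(CC\<^sup>* + \<lambda>I)\<^sup>-\<^sup>1\<close>. Finally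
  \<open>A\<^sup>kT\<close> and \<open>TA\<^sup>k\<close> satisfy the equations that characterise the core-EP inverse and its dual.\<close>

section \<open>Conjugate transposes and matrix powers\<close>

lemma conj_transpose_nth: "conj_transpose M $ i $ j = cnj (M $ j $ i)"
  by (simp add: conj_transpose_def map_matrix_def transpose_def)

lemma conj_transpose_conj_transpose [simp]: "conj_transpose (conj_transpose M) = M"
  by (simp add: vec_eq_iff conj_transpose_nth)

lemma conj_transpose_mult:
  "conj_transpose (M ** N) = conj_transpose N ** conj_transpose M"
  by (simp add: vec_eq_iff conj_transpose_nth matrix_matrix_mult_def mult.commute)

lemma conj_transpose_mat_1 [simp]: "conj_transpose (mat 1) = mat 1"
  by (simp add: vec_eq_iff conj_transpose_nth mat_def)

lemma mat_pow_add: "mat_pow A (m + n) = mat_pow A m ** mat_pow A n"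
  by (induction m) (simp_all add: matrix_mul_assoc)

lemma mat_pow_Suc_right: "mat_pow A (Suc m) = mat_pow A m ** A"
  using mat_pow_add[of A m 1] by simp

lemma mat_pow_commute:
  assumes "A ** X = X ** A"
  shows "mat_pow A m ** X = X ** mat_pow A m"
proof (induction m)
  case (Suc m)
  then show ?case using assms
    by (metis mat_pow.simps(2) matrix_mul_assoc)
qed simp

lemma conj_transpose_mat_pow: "conj_transpose (mat_pow A m) = mat_pow (conj_transpose A) m"
proof (induction m)
  case (Suc m)
  then show ?case
    using mat_pow_Suc_right[of A m] by (simp add: conj_transpose_mult)
qed simp

lemma matrix_add_rdistrib: "(A + B) ** C = A ** C + B ** C"
  by (simp add: vec_eq_iff matrix_matrix_mult_def distrib_right sum.distrib)

lemma matrix_diff_ldistrib: "A ** (B - C) = A ** B - A ** (C :: 'a::ring_1^'n^'m)"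
  by (simp add: vec_eq_iff matrix_matrix_mult_def right_diff_distrib sum_subtractf)

lemma matrix_diff_rdistrib: "(A - B) ** C = A ** C - B ** (C :: 'a::ring_1^'n^'m)"
  by (simp add: vec_eq_iff matrix_matrix_mult_def left_diff_distrib sum_subtractf)

text \<open>For \<open>Y = C X\<close> the hypothesis gives \<open>Y^* Y = 0\<close>, and each
  diagonal entry of \<open>Y^* Y\<close> is the sum of the squared moduli in a column of
  \<open>Y\<close>.\<close>

lemma conj_transpose_mult_cancel:
  fixes C :: "complex^'n^'m" and X :: "complex^'p^'n"
  assumes "conj_transpose C ** C ** X = 0"
  shows "C ** X = 0"
proof -
  define Y where "Y = C ** X"
  have "conj_transpose Y ** Y = conj_transpose X ** (conj_transpose C ** C ** X)"
    by (simp add: Y_def conj_transpose_mult matrix_mul_assoc)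
  also have "\<dots> = 0"
    by (simp add: assms)
  finally have Y: "conj_transpose Y ** Y = 0" .
  have "Y $ i $ j = 0" for i j
  proof -
    have "0 = (conj_transpose Y ** Y) $ j $ j"
      by (simp add: Y)
    also have "\<dots> = (\<Sum>i\<in>UNIV. cnj (Y $ i $ j) * Y $ i $ j)"
      by (simp add: matrix_matrix_mult_def conj_transpose_nth)
    also have "\<dots> = (\<Sum>i\<in>UNIV. complex_of_real ((cmod (Y $ i $ j))\<^sup>2))"
      by (intro sum.cong refl) (metis complex_norm_square mult.commute of_real_power)
    also have "\<dots> = complex_of_real (\<Sum>i\<in>UNIV. (cmod (Y $ i $ j))\<^sup>2)"
      by simp
    finally have "(\<Sum>i\<in>UNIV. (cmod (Y $ i $ j))\<^sup>2) = 0"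
      by (metis of_real_eq_0_iff)
    then show ?thesis
      by (simp add: sum_nonneg_eq_0_iff)
  qed
  then show ?thesis
    by (simp add: Y_def[symmetric] vec_eq_iff)
qed

section \<open>Generalised inverses, ranges and rank\<close>

text \<open>A linear map that inverts \<open>N\<close> from the right on the range of
  \<open>N\<close> exists; \<open>J\<close> is its matrix.\<close>

lemma inner_inverse_exists:
  fixes N :: "'a::field^'n^'m"
  obtains J where "N ** J ** N = N"
proof -
  obtain g where g: "Vector_Spaces.linear (*s) (*s) g" "\<forall>v\<in>(*v) N ` UNIV. N *v (g v) = v"
    using vec.linear_exists_right_inverse_on[OF matrix_vector_mul_linear_gen[of N] vec.subspace_UNIV]
    by blast
  have "N ** matrix g ** N = N"
    unfolding matrix_eq using g(2) matrix_works[OF g(1)]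
    by (simp add: matrix_vector_mul_assoc[symmetric])
  then show ?thesis by (rule that)
qed

lemma range_mult_subset: "range ((*v) (N ** U)) \<subseteq> range ((*v) N)"
  by (auto simp: matrix_vector_mul_assoc[symmetric])

text \<open>With an inner inverse \<open>J\<close> of \<open>N\<close>, the product
  \<open>N J\<close> fixes the range of \<open>N\<close> and hence every column of \<open>M\<close>,
  so \<open>U = J M\<close> works.\<close>

lemma range_subset_imp_factor:
  fixes M :: "'a::field^'n^'m" and N :: "'a^'p^'m"
  assumes "range ((*v) M) \<subseteq> range ((*v) N)"
  obtains U where "M = N ** U"
proof -
  obtain J where J: "N ** J ** N = N"
    by (rule inner_inverse_exists)
  have "M *v x = (N ** (J ** M)) *v x" for x
  proof -
    obtain y where "M *v x = N *v y" using assms by blast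
    then show ?thesis using J by (metis matrix_mul_assoc matrix_vector_mul_assoc)
  qed
  then show ?thesis
    using that[of "J ** M"] by (simp add: matrix_eq)
qed

text \<open>This turns the range conditions in both definitions of core-EP inverses into matrix
  identities.\<close>

lemma mat_range_subset_iff: "mat_range M \<subseteq> mat_range N \<longleftrightarrow> (\<exists>U. M = N ** U)"
  unfolding mat_range_def by (metis range_subset_imp_factor range_mult_subset)

lemma matrix_vector_mult_axis:
  fixes A :: "'a::field^'n^'m"
  shows "A *v axis k 1 = column k A"
  by (simp add: vec_eq_iff matrix_vector_mult_def column_def axis_def
      if_distrib[of "\<lambda>x. _ * x"] cong: if_cong)

lemma rank_eq_dim_range_transpose:
  fixes M :: "'a::field^'n^'m"
  shows "rank M = vec.dim (range ((*v) (transpose M)))"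
proof -
  have "range ((*v) (transpose M)) \<subseteq> vec.span (columns (transpose M))"
    using matrix_vector_mult_in_columnspace_gen by blast
  moreover have "vec.span (columns (transpose M)) \<subseteq> range ((*v) (transpose M))"
  proof (rule vec.span_minimal)
    show "columns (transpose M) \<subseteq> range ((*v) (transpose M))"
      by (auto simp: columns_def matrix_vector_mult_axis[symmetric] simp del: transpose_matrix_vector)
    show "vec.subspace (range ((*v) (transpose M)))"
      using vec.linear_subspace_image[OF matrix_vector_mul_linear_gen vec.subspace_UNIV] .
  qed
  ultimately have "range ((*v) (transpose M)) = vec.span (rows M)"
    by simp
  then show ?thesis
    by (simp only: row_rank_def_gen vec.dim_span)
qed

lemma range_transpose_mult_subset:
  fixes M :: "'a::field^'n^'m" and A :: "'a^'m^'p"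
  shows "range ((*v) (transpose (A ** M))) \<subseteq> range ((*v) (transpose M))"
  unfolding matrix_transpose_mul by (rule range_mult_subset)

lemma rank_mult_le_right:
  fixes M :: "'a::field^'n^'m" and A :: "'a^'m^'p"
  shows "rank (A ** M) \<le> rank M"
  unfolding rank_eq_dim_range_transpose
  by (rule vec.dim_subset[OF range_transpose_mult_subset])

text \<open>The row space of \<open>A M\<close> lies in that of \<open>M\<close>. Equal rank makes
  them equal, so the rows of \<open>M\<close> are combinations of the rows of \<open>A M\<close>,
  with coefficients \<open>W\<close>.\<close>

lemma rank_mult_eq_iff:
  fixes M :: "'a::field^'n^'m" and A :: "'a^'m^'p"
  shows "rank M = rank (A ** M) \<longleftrightarrow> (\<exists>W. M = W ** (A ** M))"
proof
  assume eq: "rank M = rank (A ** M)"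
  have sub: "vec.subspace (range ((*v) (N :: 'a^'q^'r)))" for N
    using vec.linear_subspace_image[OF matrix_vector_mul_linear_gen vec.subspace_UNIV] .
  have "range ((*v) (transpose (A ** M))) = range ((*v) (transpose M))"
    using eq by (intro vec.subspace_dim_equal sub range_transpose_mult_subset)
      (simp add: rank_eq_dim_range_transpose)
  then obtain U where "transpose M = transpose (A ** M) ** U"
    using range_subset_imp_factor by (metis order_refl)
  then show "\<exists>W. M = W ** (A ** M)"
    by (metis matrix_transpose_mul transpose_transpose)
next
  assume "\<exists>W. M = W ** (A ** M)"
  then show "rank M = rank (A ** M)"
    by (metis rank_mult_le_right order_antisym)
qed

section \<open>The index and the Drazin inverse\<close>

text \<open>If \<open>A\<^sup>m = W A\<^sup>m\<^sup>+\<^sup>1\<close>, then \<open>A\<close> is injective, hence surjective, on the range of \<open>A\<^sup>m\<close>.\<close>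

lemma mat_pow_right_factor:
  fixes A :: "complex^'n^'n"
  assumes "mat_pow A m = W ** mat_pow A (Suc m)"
  shows "\<exists>U. mat_pow A m = mat_pow A (Suc m) ** U"
proof -
  let ?V = "range ((*v) (mat_pow A m))"
  have V: "vec.subspace ?V"
    using vec.linear_subspace_image[OF matrix_vector_mul_linear_gen vec.subspace_UNIV] .
  have im: "(*v) A ` ?V = range ((*v) (mat_pow A (Suc m)))"
    by (auto simp: matrix_vector_mul_assoc image_iff)
  have "inj_on ((*v) A) ?V"
  proof (rule inj_onI)
    fix x y assume "x \<in> ?V" "y \<in> ?V" and eq: "A *v x = A *v y"
    then obtain a b where ab: "x = mat_pow A m *v a" "y = mat_pow A m *v b" by blast
    \<comment> \<open>\<open>W\<close> inverts \<open>A\<close> from the left on the range of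
      \<open>A^m\<close>: \<open>W A A^m a = A^m a\<close>.\<close>
    have "W *v (A *v x) = x" "W *v (A *v y) = y"
      using assms by (simp_all add: ab matrix_vector_mul_assoc matrix_mul_assoc)
    then show "x = y" using eq by metis
  qed
  then have "vec.dim ((*v) A ` ?V) = vec.dim ?V"
    by (intro vec.dim_image_eq matrix_vector_mul_linear_gen)
      (simp add: vec.span_eq_iff[THEN iffD2, OF V])
  moreover have "range ((*v) (mat_pow A (Suc m))) \<subseteq> ?V"
    unfolding mat_pow_Suc_right by (rule range_mult_subset)
  moreover have "vec.subspace ((*v) A ` ?V)"
    by (rule vec.linear_subspace_image[OF matrix_vector_mul_linear_gen V])
  ultimately have "range ((*v) (mat_pow A (Suc m))) = ?V"
    unfolding im using V by (intro vec.subspace_dim_equal) auto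
  then show ?thesis
    using range_subset_imp_factor by (metis order_refl)
qed

lemma conj_transpose_factor_iff:
  "(\<exists>W. conj_transpose M = W ** conj_transpose N) \<longleftrightarrow> (\<exists>U. M = N ** U)"
proof
  assume "\<exists>W. conj_transpose M = W ** conj_transpose N"
  then obtain W where "conj_transpose M = W ** conj_transpose N" ..
  from arg_cong[OF this, of conj_transpose] show "\<exists>U. M = N ** U"
    by (auto simp: conj_transpose_mult)
qed (auto simp: conj_transpose_mult)

text \<open>The remaining direction is \<open>mat_pow_right_factor\<close> for the adjoint, since
  conjugate transposition exchanges left and right factors.\<close>

lemma mat_pow_left_factor_iff:
  fixes A :: "complex^'n^'n"
  shows "(\<exists>W. mat_pow A m = W ** mat_pow A (Suc m)) \<longleftrightarrow>
    (\<exists>U. mat_pow A m = mat_pow A (Suc m) ** U)"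
proof
  assume "\<exists>U. mat_pow A m = mat_pow A (Suc m) ** U"
  then obtain U where "mat_pow A m = mat_pow A (Suc m) ** U" by blast
  then have "mat_pow (conj_transpose A) m =
      conj_transpose U ** mat_pow (conj_transpose A) (Suc m)"
    by (metis conj_transpose_mult conj_transpose_mat_pow)
  then obtain V where "mat_pow (conj_transpose A) m = mat_pow (conj_transpose A) (Suc m) ** V"
    using mat_pow_right_factor by blast
  then show "\<exists>W. mat_pow A m = W ** mat_pow A (Suc m)"
    by (metis conj_transpose_mult conj_transpose_mat_pow conj_transpose_conj_transpose)
qed (use mat_pow_right_factor in blast)

lemma rank_mat_pow_eq_iff:
  "rank (mat_pow A m) = rank (mat_pow A (m + 1)) \<longleftrightarrow>
    (\<exists>W. mat_pow A m = W ** mat_pow A (Suc m))"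
  using rank_mult_eq_iff[of "mat_pow A m" A] by simp

text \<open>Stabilisation of the rank at \<open>m\<close> is a left factorisation of
  \<open>A^m\<close>, equivalently a right one, and the adjoint interchanges the two. Both indices
  are therefore least elements of the same set.\<close>

lemma mat_index_conj_transpose: "mat_index (conj_transpose A) = mat_index A"
proof -
  have "(\<exists>W. mat_pow (conj_transpose A) m = W ** mat_pow (conj_transpose A) (Suc m)) \<longleftrightarrow>
      (\<exists>U. mat_pow A m = mat_pow A (Suc m) ** U)" for m
    using conj_transpose_factor_iff[of "mat_pow A m" "mat_pow A (Suc m)"]
    unfolding conj_transpose_mat_pow .
  then show ?thesis
    unfolding mat_index_def rank_mat_pow_eq_iff mat_pow_left_factor_iff[of A] by simp
qed

text \<open>The \<open>LEAST\<close> in the index is attained: without stabilisation the ranks would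
  decrease strictly forever.\<close>

lemma rank_mat_pow_mat_index:
  fixes A :: "complex^'n^'n"
  shows "rank (mat_pow A (mat_index A)) = rank (mat_pow A (mat_index A + 1))"
proof -
  have "\<exists>m. rank (mat_pow A m) = rank (mat_pow A (m + 1))"
  proof (rule ccontr)
    assume "\<nexists>m. rank (mat_pow A m) = rank (mat_pow A (m + 1))"
    moreover have "rank (mat_pow A (m + 1)) \<le> rank (mat_pow A m)" for m
      using rank_mult_le_right by simp
    ultimately have less: "rank (mat_pow A (m + 1)) < rank (mat_pow A m)" for m
      by (metis order_le_imp_less_or_eq)
    have "rank (mat_pow A m) + m \<le> rank (mat_pow A 0)" for m
    proof (induction m)
      case (Suc m)
      then show ?case using less[of m] by simp
    qed simp
    from this[of "rank (mat_pow A 0) + 1"] show False by simp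
  qed
  then show ?thesis
    unfolding mat_index_def by (rule LeastI_ex)
qed

text \<open>From \<open>A^k = A^(k+1) V\<close>, multiplication by \<open>A^j\<close> gives
  \<open>A^(k+j) = A^(k+j+1) V\<close>, so each induction step puts one more \<open>V\<close> in
  front of \<open>U\<close>.\<close>

lemma mat_pow_index_factor:
  fixes A :: "complex^'n^'n"
  shows "\<exists>U. mat_pow A (mat_index A) = mat_pow A (mat_index A + j) ** U"
proof (induction j)
  case 0
  show ?case by (intro exI[of _ "mat 1"]) simp
next
  case (Suc j)
  then obtain U where U: "mat_pow A (mat_index A) = mat_pow A (mat_index A + j) ** U" ..
  obtain V where V: "mat_pow A (mat_index A) = mat_pow A (Suc (mat_index A)) ** V"
    using rank_mat_pow_mat_index[of A] rank_mat_pow_eq_iff mat_pow_left_factor_iff by blast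
  have "mat_pow A (mat_index A + j) = mat_pow A j ** (mat_pow A (Suc (mat_index A)) ** V)"
    by (metis V add.commute mat_pow_add)
  also have "\<dots> = mat_pow A (mat_index A + Suc j) ** V"
    unfolding matrix_mul_assoc mat_pow_add[symmetric] by (simp add: add.commute)
  finally show ?case
    using U by (metis matrix_mul_assoc)
qed

lemma drazin_inverse_exists:
  fixes A :: "complex^'n^'n"
  defines "k \<equiv> mat_index A"
  obtains D where "mat_pow A (k + 1) ** D = mat_pow A k" "D ** A ** D = D" "A ** D = D ** A"
proof -
  define B where "B = mat_pow A k"
  \<comment> \<open>The exponent \<open>2k+1\<close> is chosen so that \<open>E = B A B\<close>;
    this is what yields \<open>D A D = W B A B U = D\<close> below.\<close>
  define E where "E = mat_pow A (k + (k + 1))"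
  have E: "E = B ** A ** B"
    unfolding E_def B_def mat_pow_add[of A k "k + 1"] by (simp add: matrix_mul_assoc)
  have AE: "A ** E = E ** A" and AB: "A ** B = B ** A"
    unfolding E_def B_def by (rule mat_pow_commute[OF refl, symmetric])+
  obtain U where U: "B = E ** U"
    using mat_pow_index_factor[of A "k + 1"] unfolding B_def E_def k_def by blast
  \<comment> \<open>The adjoint has the same index, so its right factor \<open>V\<close>, conjugate
    transposed, is a left factor for \<open>A\<close>.\<close>
  obtain W where W: "B = W ** E"
  proof -
    obtain V where "mat_pow (conj_transpose A) k = mat_pow (conj_transpose A) (k + (k + 1)) ** V"
      using mat_pow_index_factor[of "conj_transpose A" "k + 1"]
      unfolding mat_index_conj_transpose k_def by blast
    then have "B = conj_transpose V ** E"
      unfolding B_def E_def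
      by (metis conj_transpose_mult conj_transpose_mat_pow conj_transpose_conj_transpose)
    then show ?thesis by (rule that)
  qed
  define D where "D = W ** E ** U"
  have D1: "D = W ** B" and D2: "D = B ** U"
    unfolding D_def using U W by (metis matrix_mul_assoc)+
  \<comment> \<open>\<open>A B U = B A U = W E A U = W A E U = W A B = W B A\<close>.\<close>
  have "A ** D = D ** A"
    by (metis D1 D2 AB AE U W matrix_mul_assoc)
  moreover have "D ** A ** D = D"
  proof -
    have "D ** A ** D = W ** B ** A ** (B ** U)"
      by (simp flip: D1 D2)
    also have "\<dots> = D"
      by (simp add: D_def E matrix_mul_assoc)
    finally show ?thesis .
  qed
  moreover have "mat_pow A (k + 1) ** D = mat_pow A k"
  proof -
    have "mat_pow A (k + 1) ** D = A ** B ** (B ** U)"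
      by (simp add: B_def D2)
    also have "\<dots> = B ** A ** B ** U"
      by (simp add: AB matrix_mul_assoc)
    finally show ?thesis
      using U E B_def by metis
  qed
  ultimately show ?thesis using that by blast
qed

text \<open>The hypotheses give \<open>X = A X X\<close>; substituting this into itself
  \<open>j\<close> times pulls out the factor \<open>A^j\<close>.\<close>

lemma outer_inverse_eq_mat_pow:
  assumes "X ** A ** X = X" "A ** X = X ** A"
  shows "X = mat_pow A j ** mat_pow X (j + 1)"
proof (induction j)
  case (Suc j)
  have "X = A ** X ** X"
    using assms by metis
  also have "\<dots> = A ** (mat_pow A j ** mat_pow X (j + 1)) ** X"
    using Suc by metis
  also have "\<dots> = mat_pow A (Suc j) ** (mat_pow X (j + 1) ** X)"
    by (simp add: matrix_mul_assoc)
  finally show ?case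
    by (simp only: mat_pow_Suc_right Suc_eq_plus1[symmetric])
qed simp

text \<open>Both matrices equal \<open>Y A X\<close>. Writing \<open>X = A^k X^(k+1)\<close> and
  using \<open>Y A^(k+1) = A^k\<close> gives \<open>X\<close>; writing
  \<open>Y = Y^(k+1) A^k\<close> and using \<open>A^(k+1) X = A^k\<close> gives
  \<open>Y\<close>.\<close>

lemma drazin_inverse_unique:
  assumes X: "mat_pow A (k + 1) ** X = mat_pow A k" "X ** A ** X = X" "A ** X = X ** A"
    and Y: "mat_pow A (k + 1) ** Y = mat_pow A k" "Y ** A ** Y = Y" "A ** Y = Y ** A"
  shows "X = Y"
proof -
  have *: "V ** A ** U = U"
    if U: "mat_pow A (k + 1) ** U = mat_pow A k" "U ** A ** U = U" "A ** U = U ** A"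
      and V: "mat_pow A (k + 1) ** V = mat_pow A k" "A ** V = V ** A" for U V
  proof -
    have "V ** A ** U = V ** A ** (mat_pow A k ** mat_pow U (k + 1))"
      using outer_inverse_eq_mat_pow[OF U(2,3), of k] by simp
    also have "\<dots> = (V ** mat_pow A (k + 1)) ** mat_pow U (k + 1)"
      by (simp add: matrix_mul_assoc)
    also have "V ** mat_pow A (k + 1) = mat_pow A k"
      using mat_pow_commute[OF V(2)] V(1) by metis
    finally show ?thesis
      using outer_inverse_eq_mat_pow[OF U(2,3), of k] by simp
  qed
  have "X = Y ** A ** X" using *[OF X Y(1,3)] by simp
  also have "\<dots> = X ** A ** Y"
  proof -
    have "X ** A ** Y = Y" using *[OF Y X(1,3)] .
    moreover have "Y ** A ** X = Y"
    proof -
      have "Y ** A ** X = mat_pow Y (k + 1) ** mat_pow A k ** A ** X"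
        using outer_inverse_eq_mat_pow[OF Y(2,3), of k]
          mat_pow_commute[OF mat_pow_commute[OF Y(3), of k, symmetric], of "k + 1"] by metis
      also have "\<dots> = mat_pow Y (k + 1) ** (mat_pow A (k + 1) ** X)"
        using mat_pow_Suc_right[of A k] by (simp add: matrix_mul_assoc[symmetric])
      also have "\<dots> = mat_pow Y (k + 1) ** mat_pow A k" by (simp only: X(1))
      also have "\<dots> = Y"
        using outer_inverse_eq_mat_pow[OF Y(2,3), of k]
          mat_pow_commute[OF mat_pow_commute[OF Y(3), of k, symmetric], of "k + 1"] by metis
      finally show ?thesis .
    qed
    ultimately show ?thesis by simp
  qed
  also have "\<dots> = Y" using *[OF Y X(1,3)] .
  finally show ?thesis .
qed

lemma drazin_inverse_equations:
  fixes A :: "complex^'n^'n"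
  shows "mat_pow A (mat_index A + 1) ** drazin_inverse A = mat_pow A (mat_index A)"
    and "drazin_inverse A ** A ** drazin_inverse A = drazin_inverse A"
    and "A ** drazin_inverse A = drazin_inverse A ** A"
proof -
  let ?P = "\<lambda>X. mat_pow A (mat_index A + 1) ** X = mat_pow A (mat_index A) \<and>
    X ** A ** X = X \<and> A ** X = X ** A"
  obtain D where "?P D" using drazin_inverse_exists[of A] by blast
  then have "?P (drazin_inverse A)"
    unfolding drazin_inverse_def by (rule theI) (use \<open>?P D\<close> drazin_inverse_unique in blast)
  then show "mat_pow A (mat_index A + 1) ** drazin_inverse A = mat_pow A (mat_index A)"
    and "drazin_inverse A ** A ** drazin_inverse A = drazin_inverse A"
    and "A ** drazin_inverse A = drazin_inverse A ** A" by auto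
qed

section \<open>The core-EP inverse through the Moore--Penrose inverse\<close>

text \<open>Both matrices equal \<open>Y A X\<close>: equal ranges give \<open>X = Y U\<close>, and
  \<open>Y A\<close> fixes \<open>Y\<close>; equal ranges of the adjoints give
  \<open>Y = V^* X\<close>, and \<open>X\<close> is fixed by \<open>A X\<close> from the
  right.\<close>

lemma outer_inverse_unique:
  fixes A X Y :: "complex^'n^'n"
  assumes "X ** A ** X = X" "mat_range X = S" "mat_range (conj_transpose X) = S"
    and "Y ** A ** Y = Y" "mat_range Y = S" "mat_range (conj_transpose Y) = S"
  shows "X = Y"
proof -
  obtain U where "X = Y ** U"
    using assms mat_range_subset_iff by (metis order_refl)
  then have "Y ** A ** X = X"
    using assms(4) by (metis matrix_mul_assoc)
  moreover obtain V where "conj_transpose Y = conj_transpose X ** V"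
    using assms mat_range_subset_iff by (metis order_refl)
  then have "Y = conj_transpose V ** X"
    by (metis conj_transpose_mult conj_transpose_conj_transpose)
  then have "Y ** A ** X = Y"
    using assms(1) by (metis matrix_mul_assoc)
  ultimately show ?thesis by simp
qed

text \<open>Here \<open>T\<close> is a {1,2,3}-inverse of \<open>C\<close>, so \<open>C T\<close> is
  the orthogonal projection onto the range of \<open>C\<close>, which is also the range of the
  Drazin inverse. The identity \<open>A X = C T\<close> transfers this to \<open>X\<close> and its
  adjoint.\<close>

lemma core_EP_equations:
  fixes A T :: "complex^'n^'n"
  defines "k \<equiv> mat_index A"
  defines "C \<equiv> mat_pow A (k + 1)"
  defines "X \<equiv> mat_pow A k ** T"
  assumes T: "C ** T ** C = C" "T ** C ** T = T" "conj_transpose (C ** T) = C ** T"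
  shows "X ** A ** X = X" "mat_range X = mat_range (drazin_inverse A)"
    and "mat_range (conj_transpose X) = mat_range (drazin_inverse A)"
proof -
  define B where "B = mat_pow A k"
  define D where "D = drazin_inverse A"
  have D: "C ** D = B" "D ** A ** D = D" "A ** D = D ** A"
    using drazin_inverse_equations[of A] unfolding C_def B_def D_def k_def by auto
  have DC: "D ** C = B"
    using mat_pow_commute[OF D(3), of "k + 1"] D(1) unfolding C_def by simp
  have C: "C = A ** B" "C = B ** A"
    unfolding C_def B_def using mat_pow_Suc_right[of A k] by simp_all
  have DB: "D = B ** mat_pow D (k + 1)"
    unfolding B_def by (rule outer_inverse_eq_mat_pow[OF D(2,3)])
  have X: "X = B ** T" by (simp add: X_def B_def)
  have "X ** A ** X = B ** (T ** C ** T)"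
    by (simp add: X C(1) matrix_mul_assoc)
  then show "X ** A ** X = X"
    by (simp add: T X)
  \<comment> \<open>\<open>B = D C = D C T C = B T C\<close>.\<close>
  have B: "B = X ** C"
    by (metis X DC T(1) matrix_mul_assoc)
  have D_eq: "D = X ** (C ** mat_pow D (k + 1))"
    using B DB by (metis matrix_mul_assoc)
  have X_eq: "X = D ** (C ** T)"
    by (simp add: X DC[symmetric] matrix_mul_assoc)
  show "mat_range X = mat_range (drazin_inverse A)"
    unfolding D_def[symmetric]
  proof (rule subset_antisym)
    show "mat_range X \<subseteq> mat_range D"
      unfolding mat_range_subset_iff using X_eq by blast
    show "mat_range D \<subseteq> mat_range X"
      unfolding mat_range_subset_iff using D_eq by blast
  qed
  have AX: "A ** X = C ** T"
    by (simp add: X C(1) matrix_mul_assoc)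
  then have Q: "conj_transpose X ** conj_transpose A = C ** T"
    by (metis T(3) conj_transpose_mult)
  show "mat_range (conj_transpose X) = mat_range (drazin_inverse A)"
    unfolding D_def[symmetric]
  proof (rule subset_antisym)
    \<comment> \<open>The adjoint of \<open>X = D (C T)\<close> starts with \<open>C\<close>, and
      \<open>C = B A = D C A\<close> starts with \<open>D\<close>.\<close>
    have "conj_transpose X = C ** T ** conj_transpose D"
      by (metis X_eq conj_transpose_mult T(3))
    also have "C = D ** (C ** A)"
      by (metis C(2) DC matrix_mul_assoc)
    finally have "conj_transpose X = D ** (C ** A ** T ** conj_transpose D)"
      by (simp add: matrix_mul_assoc)
    then show "mat_range (conj_transpose X) \<subseteq> mat_range D"
      unfolding mat_range_subset_iff by blast
    \<comment> \<open>Conversely \<open>D = B D^(k+1)\<close> with \<open>B = C D\<close>, and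
      \<open>C = C T C\<close> starts with \<open>X^*\<close> because
      \<open>C T = X^* A^*\<close>.\<close>
    have "D = C ** D ** mat_pow D (k + 1)"
      using DB D(1) by metis
    also have "C = conj_transpose X ** conj_transpose A ** C"
      by (metis Q T(1))
    finally have "D = conj_transpose X ** (conj_transpose A ** C ** D ** mat_pow D (k + 1))"
      by (simp add: matrix_mul_assoc)
    then show "mat_range D \<subseteq> mat_range (conj_transpose X)"
      unfolding mat_range_subset_iff by blast
  qed
qed

lemma core_EP_inverse_eq:
  fixes A T :: "complex^'n^'n"
  defines "k \<equiv> mat_index A"
  defines "C \<equiv> mat_pow A (k + 1)"
  assumes T: "C ** T ** C = C" "T ** C ** T = T" "conj_transpose (C ** T) = C ** T"
  shows "core_EP_inverse A = mat_pow A k ** T"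
proof -
  note X = core_EP_equations[OF T[unfolded C_def k_def], folded k_def]
  show ?thesis
    unfolding core_EP_inverse_def
  proof (rule the_equality, goal_cases)
    case 1
    show ?case using X by simp
  next
    case (2 Y)
    show ?case by (rule outer_inverse_unique[where A = A]) (use 2 X in auto)
  qed
qed

text \<open>\<open>T^*\<close> is a {1,2,3}-inverse of \<open>C^*\<close>, because
  \<open>C^* T^*\<close> is the adjoint of the Hermitian matrix \<open>T C\<close>. The equations
  for the core-EP inverse of \<open>A^*\<close> are then conjugate transposed.\<close>

lemma dual_core_EP_inverse_eq:
  fixes A T :: "complex^'n^'n"
  defines "k \<equiv> mat_index A"
  defines "C \<equiv> mat_pow A (k + 1)"
  assumes T: "C ** T ** C = C" "T ** C ** T = T" "conj_transpose (T ** C) = T ** C"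
  shows "dual_core_EP_inverse A = T ** mat_pow A k"
proof -
  let ?A = "conj_transpose A" and ?T = "conj_transpose T" and ?X = "T ** mat_pow A k"
  have C: "mat_pow ?A (k + 1) = conj_transpose C"
    unfolding C_def conj_transpose_mat_pow ..
  have X': "mat_pow ?A k ** ?T = conj_transpose ?X"
    by (simp add: conj_transpose_mult conj_transpose_mat_pow)
  have T': "conj_transpose C ** ?T ** conj_transpose C = conj_transpose C"
    "?T ** conj_transpose C ** ?T = ?T"
    "conj_transpose (conj_transpose C ** ?T) = conj_transpose C ** ?T"
    using T by (metis conj_transpose_mult matrix_mul_assoc)+
  note X = core_EP_equations[of ?A ?T, unfolded mat_index_conj_transpose, folded k_def,
      unfolded C X', OF T']
  have XAX: "?X ** A ** ?X = ?X"
    using X(1) by (metis conj_transpose_mult matrix_mul_assoc conj_transpose_conj_transpose)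
  show ?thesis
    unfolding dual_core_EP_inverse_def
  proof (rule the_equality, goal_cases)
    case 1
    show ?case using X XAX by simp
  next
    case (2 Y)
    show ?case by (rule outer_inverse_unique[where A = A]) (use 2 X XAX in auto)
  qed
qed

section \<open>Regularised inverses\<close>

lemma tendsto_matrix_mult:
  fixes f :: "'b \<Rightarrow> 'a::real_normed_field^'n^'m" and g :: "'b \<Rightarrow> 'a^'p^'n"
  assumes "(f \<longlongrightarrow> a) F" "(g \<longlongrightarrow> b) F"
  shows "((\<lambda>x. f x ** g x) \<longlongrightarrow> a ** b) F"
  unfolding matrix_matrix_mult_def by (intro tendsto_intros assms)

lemma tendsto_det:
  fixes f :: "'b \<Rightarrow> 'a::real_normed_field^'n^'n"
  assumes "(f \<longlongrightarrow> a) F"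
  shows "((\<lambda>x. det (f x)) \<longlongrightarrow> det a) F"
  unfolding det_def by (intro tendsto_intros assms)

lemma matrix_inv_eqI:
  fixes A B :: "'a::field^'n^'n"
  assumes "A ** B = mat 1"
  shows "matrix_inv A = B"
proof -
  have "\<exists>A'. A ** A' = mat 1 \<and> A' ** A = mat 1"
    using assms matrix_left_right_inverse by blast
  then have "A ** matrix_inv A = mat 1 \<and> matrix_inv A ** A = mat 1"
    unfolding matrix_inv_def by (rule someI_ex)
  then show ?thesis
    by (metis assms matrix_mul_assoc matrix_mul_lid matrix_mul_rid)
qed

lemma matrix_inv_right:
  fixes A :: "'a::field^'n^'n"
  assumes "det A \<noteq> 0"
  shows "A ** matrix_inv A = mat 1"
  using assms matrix_inv_eqI by (metis invertible_det_nz invertible_right_inverse)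

text \<open>By Cramer's rule the entries of the inverse are quotients of determinants, and
  determinants are continuous.\<close>

lemma tendsto_matrix_inv:
  fixes f :: "'b \<Rightarrow> 'a::real_normed_field^'n^'n"
  assumes f: "(f \<longlongrightarrow> a) F" and "det a \<noteq> 0"
  shows "((\<lambda>x. matrix_inv (f x)) \<longlongrightarrow> matrix_inv a) F"
proof -
  \<comment> \<open>Entry \<open>(k, j)\<close> of the inverse by Cramer's rule: column
    \<open>k\<close> of \<open>M\<close> is replaced by the \<open>j\<close>-th unit vector.\<close>
  define R where
    "R M k j = det (\<chi> i l. if l = k then axis j 1 $ i else M $ i $ l) / det M"
    for M :: "'a^'n^'n" and k j
  have R: "matrix_inv M = (\<chi> k j. R M k j)" if "det M \<noteq> 0" for M
  proof -
    have "M *v (matrix_inv M *v axis j 1) = axis j 1" for j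
      by (simp add: matrix_vector_mul_assoc matrix_inv_right[OF that])
    then have "column j (matrix_inv M) = (\<chi> k. R M k j)" for j
      unfolding matrix_vector_mult_axis[symmetric] R_def cramer[OF that, symmetric] by blast
    then show ?thesis
      by (simp add: column_def vec_eq_iff)
  qed
  have "((\<lambda>x. R (f x) k j) \<longlongrightarrow> R a k j) F" for k j
    unfolding R_def
  proof (intro tendsto_divide tendsto_det f \<open>det a \<noteq> 0\<close> tendsto_vec_lambda)
    show "((\<lambda>x. if l = k then axis j 1 $ i else f x $ i $ l) \<longlongrightarrow>
        (if l = k then axis j 1 $ i else a $ i $ l)) F" for i l
      using tendsto_vec_nth[OF tendsto_vec_nth[OF f]] by simp
  qed
  then have "((\<lambda>x. \<chi> k j. R (f x) k j) \<longlongrightarrow> (\<chi> k j. R a k j)) F"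
    by (intro tendsto_vec_lambda)
  moreover have "\<forall>\<^sub>F x in F. det (f x) \<noteq> 0"
    using tendsto_imp_eventually_ne[OF tendsto_det[OF f] \<open>det a \<noteq> 0\<close>] .
  then have "\<forall>\<^sub>F x in F. (\<chi> k j. R (f x) k j) = matrix_inv (f x)"
    by eventually_elim (simp add: R)
  ultimately show ?thesis
    unfolding R[OF \<open>det a \<noteq> 0\<close>] by (rule Lim_transform_eventually)
qed

section \<open>Scalar matrices and the resolvent of a Hermitian matrix\<close>

lemma mat_mult_nth: "(mat c ** M) $ i $ j = c * M $ i $ j"
  by (simp add: mat_def matrix_matrix_mult_def if_distrib[of "\<lambda>x. x * _"] sum.delta cong: if_cong)

lemma mult_mat_nth: "(M ** mat c) $ i $ j = M $ i $ j * c"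
  by (simp add: mat_def matrix_matrix_mult_def if_distrib[of "\<lambda>x. _ * x"] sum.delta' cong: if_cong)

lemma mat_mult_commute:
  fixes M :: "'a::comm_semiring_1^'n^'m"
  shows "mat c ** M = M ** mat c"
  by (simp add: vec_eq_iff mat_mult_nth mult_mat_nth mult.commute)

text \<open>An inner inverse \<open>J\<close> of \<open>H^2\<close> satisfies
  \<open>H^* H (1 - J H^2) = 0\<close>; cancelling \<open>H^*\<close> gives \<open>H = Z H^2\<close>
  with \<open>Z = H J\<close>. The adjoint equation is \<open>H = H^2 Y\<close> with
  \<open>Y = Z^*\<close>, and \<open>G = Z H Y\<close> is visibly Hermitian.\<close>

lemma hermitian_group_inverse_exists:
  fixes H :: "complex^'n^'n"
  assumes H: "conj_transpose H = H"
  obtains G where "H ** G ** H = H" "G ** H ** G = G" "H ** G = G ** H" "conj_transpose G = G"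
proof -
  obtain J where J: "(H ** H) ** J ** (H ** H) = H ** H"
    by (rule inner_inverse_exists)
  have "conj_transpose H ** H ** (mat 1 - J ** (H ** H)) = 0"
    by (simp add: H matrix_diff_ldistrib J matrix_mul_assoc[of _ J])
  then have "H ** (mat 1 - J ** (H ** H)) = 0"
    by (rule conj_transpose_mult_cancel)
  then have "H = H ** J ** H ** H"
    by (simp add: matrix_diff_ldistrib matrix_mul_assoc)
  then obtain Z where Z: "H = Z ** H ** H" by blast
  define Y where "Y = conj_transpose Z"
  have Y: "H = H ** H ** Y"
    using Z H unfolding Y_def by (metis conj_transpose_mult matrix_mul_assoc)
  have ZH: "Z ** H = H ** Y"
    using Y Z by (metis matrix_mul_assoc)
  define G where "G = Z ** H ** Y"
  have HG: "H ** G = H ** Y"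
    unfolding G_def using ZH Y by (metis matrix_mul_assoc)
  have GH: "G ** H = H ** Y"
    unfolding G_def using ZH Z by (metis matrix_mul_assoc)
  have "H ** G ** H = H"
    using HG ZH Z by metis
  moreover have "G ** H ** G = G"
    unfolding GH unfolding G_def using ZH Z by (metis matrix_mul_assoc)
  moreover have "conj_transpose G = G"
    by (simp add: G_def Y_def conj_transpose_mult H matrix_mul_assoc)
  ultimately show ?thesis
    using that HG GH by metis
qed

text \<open>\<open>H\<close> kills \<open>1 - H G\<close>, so \<open>H + l\<close> acts there as the
  scalar \<open>l\<close>. On the complementary part, \<open>(H + l) G = H G (1 + l G)\<close>
  because \<open>H G\<close> fixes \<open>G\<close>. The two contributions add up to the
  identity.\<close>

lemma group_inverse_resolvent:
  fixes H :: "complex^'n^'n"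
  assumes G: "H ** G ** H = H" "G ** H ** G = G" "H ** G = G ** H"
    and l: "l \<noteq> 0" "det (mat 1 + mat l ** G) \<noteq> 0"
  shows "(H + mat l) ** (mat (1 / l) ** (mat 1 - H ** G) + G ** matrix_inv (mat 1 + mat l ** G))
    = mat 1"
proof -
  let ?M = "mat 1 + mat l ** G"
  have "H ** (mat 1 - H ** G) = 0"
    using G by (simp add: matrix_diff_ldistrib) (metis matrix_mul_assoc)
  then have "H ** (mat (1 / l) ** (mat 1 - H ** G)) = 0"
    by (metis mat_mult_commute matrix_mul_assoc matrix_mul_lid matrix_mul_rid times0_right)
  moreover have "mat l ** (mat (1 / l) ** (mat 1 - H ** G)) = mat 1 - H ** G"
    using l(1) by (simp add: vec_eq_iff mat_mult_nth)
  ultimately have 1: "(H + mat l) ** (mat (1 / l) ** (mat 1 - H ** G)) = mat 1 - H ** G"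
    by (simp add: matrix_add_rdistrib)
  have "H ** G ** (mat l ** G) = mat l ** G"
    using G by (metis mat_mult_commute matrix_mul_assoc)
  then have "(H + mat l) ** G = H ** G ** ?M"
    by (simp add: matrix_add_rdistrib matrix_add_ldistrib)
  then have 2: "(H + mat l) ** (G ** matrix_inv ?M) = H ** G"
    using matrix_inv_right[OF l(2)] by (metis matrix_mul_assoc matrix_mul_rid)
  show ?thesis
    by (simp add: matrix_add_ldistrib 1 2)
qed

lemma perturbed_identity_at_0:
  fixes G :: "complex^'n^'n"
  shows "((\<lambda>l. mat 1 + mat l ** G) \<longlongrightarrow> mat 1) (at 0)"
    and "\<forall>\<^sub>F l in at 0. det (mat 1 + mat l ** G) \<noteq> 0"
proof -
  have "((\<lambda>l::complex. \<chi> i j. (mat 1 :: complex^'n^'n) $ i $ j + l * G $ i $ j) \<longlongrightarrow>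
      (\<chi> i j. (mat 1 :: complex^'n^'n) $ i $ j + 0 * G $ i $ j)) (at 0)"
    by (intro tendsto_intros)
  moreover have "(\<chi> i j. (mat 1 :: complex^'n^'n) $ i $ j + l * G $ i $ j) = mat 1 + mat l ** G" for l
    by (simp add: vec_eq_iff mat_mult_nth)
  moreover have "mat 1 + mat 0 ** G = mat 1"
    by (simp add: vec_eq_iff mat_mult_nth)
  ultimately show lim: "((\<lambda>l. mat 1 + mat l ** G) \<longlongrightarrow> mat 1) (at 0)"
    by simp
  show "\<forall>\<^sub>F l in at 0. det (mat 1 + mat l ** G) \<noteq> 0"
    by (rule tendsto_imp_eventually_ne[OF tendsto_det[OF lim]]) simp
qed

text \<open>\<open>matrix_inv\<close> is total, so the inverse equations have to be secured near 0;
  the explicit right inverse from \<open>group_inverse_resolvent\<close> provides them.\<close>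

lemma eventually_matrix_inv_hermitian:
  fixes H :: "complex^'n^'n"
  assumes "conj_transpose H = H"
  shows "\<forall>\<^sub>F l in at 0. (H + mat l) ** matrix_inv (H + mat l) = mat 1 \<and>
    matrix_inv (H + mat l) ** (H + mat l) = mat 1"
proof -
  obtain G where G: "H ** G ** H = H" "G ** H ** G = G" "H ** G = G ** H"
    using hermitian_group_inverse_exists[OF assms] by metis
  show ?thesis
    using perturbed_identity_at_0(2)[of G] eventually_neq_at_within[of 0 0 UNIV]
  proof eventually_elim
    case (elim l)
    from group_inverse_resolvent[OF G elim(2,1)] show ?case
      using matrix_inv_eqI matrix_left_right_inverse by metis
  qed
qed

text \<open>The four equations say that \<open>T\<close> is the Moore--Penrose inverse of \<open>C\<close>.\<close>

lemma tikhonov_limit: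
  fixes C :: "complex^'n^'m"
  obtains T where "C ** T ** C = C" "T ** C ** T = T"
    "conj_transpose (C ** T) = C ** T" "conj_transpose (T ** C) = T ** C"
    "((\<lambda>l. matrix_inv (conj_transpose C ** C + mat l) ** conj_transpose C) \<longlongrightarrow> T) (at 0)"
    "((\<lambda>l. conj_transpose C ** matrix_inv (C ** conj_transpose C + mat l)) \<longlongrightarrow> T) (at 0)"
proof -
  let ?C = "conj_transpose C"
  define H where "H = ?C ** C"
  have H: "conj_transpose H = H"
    by (simp add: H_def conj_transpose_mult)
  obtain G where G: "H ** G ** H = H" "G ** H ** G = G" "H ** G = G ** H" "conj_transpose G = G"
    by (rule hermitian_group_inverse_exists[OF H])
  define T where "T = G ** ?C"
  \<comment> \<open>Cancelling \<open>C^*\<close> in \<open>H (1 - G H) = 0\<close> shows that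
    \<open>G H\<close> fixes \<open>C\<close> from the right; taking adjoints, \<open>H G\<close>
    fixes \<open>C^*\<close> from the left.\<close>
  have "?C ** C ** (mat 1 - G ** H) = 0"
    using G(1) by (simp add: H_def matrix_diff_ldistrib matrix_mul_assoc)
  then have "C ** (mat 1 - G ** H) = 0"
    by (rule conj_transpose_mult_cancel)
  then have CP: "C ** (G ** H) = C"
    by (simp add: matrix_diff_ldistrib)
  then have PC: "H ** G ** ?C = ?C"
    using G(4) H by (metis conj_transpose_mult)
  have CTC: "C ** T ** C = C"
    using CP by (simp add: T_def H_def matrix_mul_assoc)
  have TCT: "T ** C ** T = T"
    using G(2) by (simp add: T_def H_def matrix_mul_assoc)
  have CT: "conj_transpose (C ** T) = C ** T"
    by (simp add: T_def conj_transpose_mult G(4) matrix_mul_assoc)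
  have "T ** C = G ** H"
    by (simp add: T_def H_def matrix_mul_assoc)
  then have TC: "conj_transpose (T ** C) = T ** C"
    using G(3,4) H by (metis conj_transpose_mult)
  have "((\<lambda>l. G ** matrix_inv (mat 1 + mat l ** G) ** ?C) \<longlongrightarrow> G ** matrix_inv (mat 1) ** ?C) (at 0)"
    by (intro tendsto_matrix_mult tendsto_const tendsto_matrix_inv perturbed_identity_at_0) simp
  moreover have "matrix_inv (mat 1) = (mat 1 :: complex^'n^'n)"
    by (rule matrix_inv_eqI) simp
  \<comment> \<open>The singular term of the resolvent contains \<open>1 - H G\<close>, which
    annihilates \<open>C^*\<close>; only the regular term is left.\<close>
  moreover have "\<forall>\<^sub>F l in at 0. G ** matrix_inv (mat 1 + mat l ** G) ** ?C
      = matrix_inv (H + mat l) ** ?C"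
    using perturbed_identity_at_0(2)[of G] eventually_neq_at_within[of 0 0 UNIV]
  proof eventually_elim
    case (elim l)
    have "(mat 1 - H ** G) ** ?C = 0"
      using PC by (simp add: matrix_diff_rdistrib)
    then show ?case
      using matrix_inv_eqI[OF group_inverse_resolvent[OF G(1-3) elim(2,1)]]
      by (simp add: matrix_add_rdistrib matrix_mul_assoc[symmetric])
  qed
  ultimately have lim: "((\<lambda>l. matrix_inv (H + mat l) ** ?C) \<longlongrightarrow> T) (at 0)"
    using Lim_transform_eventually unfolding T_def by fastforce
  moreover have "\<forall>\<^sub>F l in at 0. matrix_inv (H + mat l) ** ?C
      = ?C ** matrix_inv (C ** ?C + mat l)"
  proof -
    have "conj_transpose (C ** ?C) = C ** ?C"
      by (simp add: conj_transpose_mult)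
    from eventually_matrix_inv_hermitian[OF H] eventually_matrix_inv_hermitian[OF this]
    show ?thesis
    proof eventually_elim
      case (elim l)
      \<comment> \<open>Push-through identity: both sides are \<open>C^* C C^* + l C^*\<close>.
        Multiplying by the two inverses, one on each side, moves \<open>C^*\<close> across.\<close>
      have "(H + mat l) ** ?C = ?C ** (C ** ?C + mat l)"
        by (simp add: H_def matrix_add_rdistrib matrix_add_ldistrib matrix_mul_assoc mat_mult_commute)
      then have "matrix_inv (H + mat l) ** ((H + mat l) ** ?C) ** matrix_inv (C ** ?C + mat l)
          = matrix_inv (H + mat l) ** (?C ** (C ** ?C + mat l)) ** matrix_inv (C ** ?C + mat l)"
        by (rule arg_cong)
      moreover have "matrix_inv (H + mat l) ** ((H + mat l) ** ?C) = ?C"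
        using elim(1) by (simp add: matrix_mul_assoc)
      moreover have "matrix_inv (H + mat l) ** (?C ** (C ** ?C + mat l)) ** matrix_inv (C ** ?C + mat l)
          = matrix_inv (H + mat l) ** ?C ** ((C ** ?C + mat l) ** matrix_inv (C ** ?C + mat l))"
        by (simp only: matrix_mul_assoc)
      ultimately show ?case
        using elim(2) by simp
    qed
  qed
  ultimately have "((\<lambda>l. ?C ** matrix_inv (C ** ?C + mat l)) \<longlongrightarrow> T) (at 0)"
    by (rule Lim_transform_eventually)
  with CTC TCT CT TC lim show ?thesis
    unfolding H_def by (rule that)
qed

theorem theorem4p3:
  fixes A :: "complex^'n^'n" and k :: nat
  assumes "\<not> nilpotent_mat A"
    and "mat_index A = k"
  shows
    "((\<lambda>l::complex. mat_pow A k ** conj_transpose (mat_pow A (k + 1)) **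
        matrix_inv (mat_pow A (k + 1) ** conj_transpose (mat_pow A (k + 1)) + mat l))
        \<longlongrightarrow> core_EP_inverse A) (at 0) \<and>
     ((\<lambda>l::complex. mat_pow A k **
        matrix_inv (conj_transpose (mat_pow A (k + 1)) ** mat_pow A (k + 1) + mat l) **
        conj_transpose (mat_pow A (k + 1)))
        \<longlongrightarrow> core_EP_inverse A) (at 0) \<and>
     ((\<lambda>l::complex.
        matrix_inv (conj_transpose (mat_pow A (k + 1)) ** mat_pow A (k + 1) + mat l) **
        conj_transpose (mat_pow A (k + 1)) ** mat_pow A k)
        \<longlongrightarrow> dual_core_EP_inverse A) (at 0) \<and>
     ((\<lambda>l::complex. conj_transpose (mat_pow A (k + 1)) **
        matrix_inv (mat_pow A (k + 1) ** conj_transpose (mat_pow A (k + 1)) + mat l) **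
        mat_pow A k)
        \<longlongrightarrow> dual_core_EP_inverse A) (at 0)"
proof -
  define C where "C = mat_pow A (k + 1)"
  obtain T where T: "C ** T ** C = C" "T ** C ** T = T"
      "conj_transpose (C ** T) = C ** T" "conj_transpose (T ** C) = T ** C"
    and lim: "((\<lambda>l. matrix_inv (conj_transpose C ** C + mat l) ** conj_transpose C) \<longlongrightarrow> T) (at 0)"
      "((\<lambda>l. conj_transpose C ** matrix_inv (C ** conj_transpose C + mat l)) \<longlongrightarrow> T) (at 0)"
    by (rule tikhonov_limit)
  have core: "core_EP_inverse A = mat_pow A k ** T"
    using core_EP_inverse_eq[of A T] T assms(2) by (simp add: C_def)
  have dual: "dual_core_EP_inverse A = T ** mat_pow A k"
    using dual_core_EP_inverse_eq[of A T] T assms(2) by (simp add: C_def)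
  \<comment> \<open>Multiplying the two limits for \<open>T\<close> by \<open>A^k\<close> on the
    left gives the core-EP limits, on the right the dual ones.\<close>
  note left = tendsto_matrix_mult[OF tendsto_const[of "mat_pow A k"]]
  note right = tendsto_matrix_mult[OF _ tendsto_const[of "mat_pow A k"]]
  show ?thesis
    unfolding core dual C_def[symmetric]
    using left[OF lim(2)] left[OF lim(1)] right[OF lim(1)] right[OF lim(2)]
    by (simp add: matrix_mul_assoc)
qed

end
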